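(* Let $0<\epsilon<\frac14$ be fixed. Suppose that for each dimension $D$ (with $d=d(D)$) there is a random positive linear map $\Phi:\mathcal{M}_D\to\mathcal{M}_d$ such that for any $Y_1,\ldots,Y_{D+1}\in\mathcal{M}_D$, with strictly positive probability, for all $i,j\in\{1,\ldots,D+1\}$, $$\big|\operatorname{Tr}(\Phi(Y_i)^T\Phi(Y_j))-\operatorname{Tr}(Y_i^TY_j)\big|\ \le\ \epsilon\,\|Y_i\|_2\,\|Y_j\|_2 .$$ Then $d=\Omega(D)$; that is, there exist a constant $c>0$ (which may depend on $\epsilon$) and $D_0$ such that $d\ge cD$ for all $D\ge D_0$.
   Context: $\mathcal{M}_n$ is the set of real $n\times n$ matrices. $\|Y\|_2=\operatorname{Tr}(Y^TY)^{1/2}$ is the Schatten $2$-norm (Hilbert-Schmidt norm). A linear map $\Phi:\mathcal{M}_D\to\mathcal{M}_d$ is called positive if it maps (symmetric) positive semidefinite matrices to (symmetric) positive semidefinite matrices. A random positive map is a random variable taking values in the positive linear maps. *)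

theory Defs
  imports "HOL-Probability.Probability" "Jordan_Normal_Form.Matrix"
begin

definition mat_trace :: "real mat \<Rightarrow> real" where
  "mat_trace A = (\<Sum>i<dim_row A. A $$ (i, i))"

definition schatten2_norm :: "real mat \<Rightarrow> real" where
  "schatten2_norm Y = sqrt (mat_trace (transpose_mat Y * Y))"

definition psd_mat :: "nat \<Rightarrow> real mat \<Rightarrow> bool" where
  "psd_mat n A \<longleftrightarrow> A \<in> carrier_mat n n \<and> transpose_mat A = A \<and>
     (\<forall>v\<in>carrier_vec n. 0 \<le> scalar_prod v (A *\<^sub>v v))"

text \<open>
  The type \<open>real mat\<close> contains matrices of all sizes, so linear maps between matrix spaces are
  relativised to carriers; the values of \<open>\<phi>\<close> outside \<open>carrier_mat m m\<close> are irrelevant.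
\<close>

definition linear_mat_map :: "nat \<Rightarrow> nat \<Rightarrow> (real mat \<Rightarrow> real mat) \<Rightarrow> bool" where
  "linear_mat_map m n \<phi> \<longleftrightarrow>
     \<phi> \<in> carrier_mat m m \<rightarrow> carrier_mat n n \<and>
     (\<forall>A\<in>carrier_mat m m. \<forall>B\<in>carrier_mat m m. \<phi> (A + B) = \<phi> A + \<phi> B) \<and>
     (\<forall>c. \<forall>A\<in>carrier_mat m m. \<phi> (c \<cdot>\<^sub>m A) = c \<cdot>\<^sub>m \<phi> A)"

definition positive_mat_map :: "nat \<Rightarrow> nat \<Rightarrow> (real mat \<Rightarrow> real mat) \<Rightarrow> bool" where
  "positive_mat_map m n \<phi> \<longleftrightarrow>
     linear_mat_map m n \<phi> \<and> (\<forall>A. psd_mat m A \<longrightarrow> psd_mat n (\<phi> A))"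

text \<open>
  The measurable space of positive maps. Its \<open>\<sigma>\<close>-algebra is generated by the entries
  \<open>\<phi> \<mapsto> (\<phi> A)\<^sub>i\<^sub>j\<close>; since these span the dual of the finite-dimensional space of linear maps,
  it is the Borel \<open>\<sigma>\<close>-algebra of that space, restricted to the positive maps. Only the
  measurable structure is used: the measure given by \<open>sigma\<close> is zero.
\<close>

definition positive_mat_maps :: "nat \<Rightarrow> nat \<Rightarrow> (real mat \<Rightarrow> real mat) measure" where
  "positive_mat_maps m n = sigma {\<phi>. positive_mat_map m n \<phi>}
     {{\<phi>. positive_mat_map m n \<phi> \<and> \<phi> A $$ (i, j) \<in> B} | A i j B.
        A \<in> carrier_mat m m \<and> i < n \<and> j < n \<and> B \<in> sets borel}"

definition random_positive_mat_map ::
    "'w measure \<Rightarrow> nat \<Rightarrow> nat \<Rightarrow> ('w \<Rightarrow> real mat \<Rightarrow> real mat) \<Rightarrow> bool" where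
  "random_positive_mat_map M m n \<Phi> \<longleftrightarrow>
     prob_space M \<and> \<Phi> \<in> measurable M (positive_mat_maps m n)"

end

theory Submission
  imports Defs
begin

text \<open>
  Take for the \<open>Y\<^sub>i\<close> the rank-one projections onto the coordinate axes together with the identity.
  The image of each projection is positive semidefinite with Hilbert-Schmidt norm at least
  \<open>sqrt (1 - \<epsilon>)\<close>, and the trace of a positive semidefinite matrix dominates that norm, so the
  image of the identity has trace at least \<open>D * sqrt (1 - \<epsilon>)\<close>. On the other hand the squared norm
  of this \<open>d \<times> d\<close> matrix is at most \<open>(1 + \<epsilon>) * D\<close>, and Cauchy-Schwarz bounds its squared trace by
  \<open>d\<close> times that.
\<close>

definition diag_unit :: "nat \<Rightarrow> nat \<Rightarrow> real mat" where
  "diag_unit n i = mat n n (\<lambda>(j, k). if j = k \<and> j = i then 1 else 0)"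

text \<open>The partial sums of the \<open>diag_unit n i\<close>, leading from the zero matrix to
  the identity, so that additivity of a map can be iterated by induction on
  \<open>m\<close>.\<close>

definition diag_below :: "nat \<Rightarrow> nat \<Rightarrow> real mat" where
  "diag_below n m = mat n n (\<lambda>(j, k). if j = k \<and> j < m then 1 else 0)"

lemma diag_unit_carrier: "diag_unit n i \<in> carrier_mat n n"
  by (simp add: diag_unit_def)

lemma diag_below_carrier: "diag_below n m \<in> carrier_mat n n"
  by (simp add: diag_below_def)

lemma diag_below_0: "diag_below n 0 = 0\<^sub>m n n"
  by (rule eq_matI) (auto simp: diag_below_def)

lemma diag_below_Suc: "diag_below n (Suc m) = diag_below n m + diag_unit n m"
  by (rule eq_matI) (auto simp: diag_below_def diag_unit_def)

lemma diag_below_self: "diag_below n n = 1\<^sub>m n"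
  by (rule eq_matI) (auto simp: diag_below_def)

lemma mat_trace_add:
  assumes "A \<in> carrier_mat n n" "B \<in> carrier_mat n n"
  shows "mat_trace (A + B) = mat_trace A + mat_trace B"
  using assms by (simp add: mat_trace_def sum.distrib)

lemma mat_trace_transpose_mult_self:
  assumes "A \<in> carrier_mat n n"
  shows "mat_trace (transpose_mat A * A) = (\<Sum>i<n. \<Sum>j<n. (A $$ (j, i))\<^sup>2)"
  using assms by (simp add: mat_trace_def scalar_prod_def power2_eq_square atLeast0LessThan)

lemma mat_trace_transpose_mult_self_nonneg:
  assumes "A \<in> carrier_mat n n"
  shows "0 \<le> mat_trace (transpose_mat A * A)"
  by (simp add: mat_trace_transpose_mult_self[OF assms] sum_nonneg)

lemma schatten2_norm_mult_self:
  assumes "A \<in> carrier_mat n n"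
  shows "schatten2_norm A * schatten2_norm A = mat_trace (transpose_mat A * A)"
  using mat_trace_transpose_mult_self_nonneg[OF assms] by (simp add: schatten2_norm_def)

lemma mat_trace_diag_unit:
  assumes "i < n"
  shows "mat_trace (transpose_mat (diag_unit n i) * diag_unit n i) = 1"
proof -
  have "mat_trace (transpose_mat (diag_unit n i) * diag_unit n i)
      = (\<Sum>k<n. \<Sum>j<n. if j = k \<and> j = i then 1 else 0)"
    unfolding mat_trace_transpose_mult_self[OF diag_unit_carrier]
    by (intro sum.cong refl) (auto simp: diag_unit_def)
  also have "\<dots> = (\<Sum>k<n. if k = i then 1 else 0)"
    by (intro sum.cong refl) (auto simp: assms intro: sum.neutral)
  finally show ?thesis using assms by simp
qed

lemma mat_trace_one: "mat_trace (transpose_mat (1\<^sub>m n) * 1\<^sub>m n) = real n"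
  by (simp add: mat_trace_def)

text \<open>The quadratic form is the square of coordinate \<open>i\<close> of the vector, or zero
  when \<open>n \<le> i\<close>.\<close>

lemma psd_mat_diag_unit: "psd_mat n (diag_unit n i)"
proof -
  have "0 \<le> scalar_prod v (diag_unit n i *\<^sub>v v)" if v: "v \<in> carrier_vec n" for v
  proof -
    have "(diag_unit n i *\<^sub>v v) $ j = (if j = i then v $ j else 0)" if "j < n" for j
    proof -
      have "(diag_unit n i *\<^sub>v v) $ j = (\<Sum>k<n. if k = j then (if j = i then v $ j else 0) else 0)"
        using v that
        by (auto simp: diag_unit_def scalar_prod_def atLeast0LessThan
            if_distrib[of "\<lambda>x. x * _"] cong: if_cong)
      then show ?thesis using that by simp
    qed
    then have "scalar_prod v (diag_unit n i *\<^sub>v v) = (\<Sum>j<n. if j = i then (v $ j)\<^sup>2 else 0)"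
      using v diag_unit_carrier[of n i]
      by (auto simp: scalar_prod_def atLeast0LessThan power2_eq_square
          if_distrib[of "\<lambda>x. _ * x"] cong: if_cong)
    then show ?thesis by (simp add: sum_nonneg)
  qed
  moreover have "transpose_mat (diag_unit n i) = diag_unit n i"
    by (rule eq_matI) (auto simp: diag_unit_def)
  ultimately show ?thesis by (simp add: psd_mat_def diag_unit_carrier)
qed

lemma binary_form_discriminant:
  fixes a b c :: real
  assumes form: "\<And>x y. 0 \<le> x\<^sup>2 * a + 2 * x * y * b + y\<^sup>2 * c"
  shows "b\<^sup>2 \<le> a * c"
proof -
  have a: "0 \<le> a" and c: "0 \<le> c" using form[of 1 0] form[of 0 1] by simp_all
  show ?thesis
  proof (cases "c = 0")
    case True
    \<comment> \<open>With \<open>c = 0\<close> the form is linear in \<open>y\<close>; this choice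
      of \<open>y\<close> makes the factor of \<open>b\<^sup>2\<close> strictly negative, which
      forces \<open>b = 0\<close>.\<close>
    have "0 \<le> b\<^sup>2 * (- a - 2)"
      using form[of b "- (a + 1)"] True by (simp add: algebra_simps power2_eq_square)
    then have "b = 0" using a by (auto simp: zero_le_mult_iff)
    then show ?thesis using True by simp
  next
    case False
    \<comment> \<open>For \<open>c > 0\<close> and \<open>x = c\<close>, the form is smallest at
      \<open>y = - b\<close>, where it equals \<open>c\<close> times the discriminant gap.\<close>
    have "0 \<le> c * (a * c - b\<^sup>2)"
      using form[of c "- b"] by (simp add: algebra_simps power2_eq_square)
    then show ?thesis using c False by (simp add: zero_le_mult_iff)
  qed
qed

lemma mat_mult_unit_vec:
  fixes A :: "'a::semiring_1 mat"
  assumes "A \<in> carrier_mat m n" "i < n"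
  shows "A *\<^sub>v unit_vec n i = col A i"
  using assms by (intro eq_vecI) auto

lemma psd_mat_diag_nonneg:
  assumes "psd_mat n A" "i < n"
  shows "0 \<le> A $$ (i, i)"
proof -
  have A: "A \<in> carrier_mat n n" using assms by (simp add: psd_mat_def)
  have "0 \<le> scalar_prod (unit_vec n i) (A *\<^sub>v unit_vec n i)"
    using assms by (simp add: psd_mat_def)
  then show ?thesis using A assms(2) by (simp add: mat_mult_unit_vec[OF A])
qed

text \<open>The quadratic form of \<open>A\<close>, restricted to combinations of the unit vectors
  \<open>i\<close> and \<open>j\<close>, is a nonnegative binary form, so its discriminant
  inequality applies.\<close>

lemma psd_mat_entry_bound:
  assumes psd: "psd_mat n A" and i: "i < n" and j: "j < n"
  shows "(A $$ (j, i))\<^sup>2 \<le> A $$ (i, i) * A $$ (j, j)"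
proof (rule binary_form_discriminant)
  fix x y :: real
  have A: "A \<in> carrier_mat n n" and sym: "transpose_mat A = A"
    using psd by (simp_all add: psd_mat_def)
  have ij: "A $$ (i, j) = A $$ (j, i)"
    using A i j by (metis carrier_matD index_transpose_mat(1) sym)
  define v where "v = x \<cdot>\<^sub>v unit_vec n i + y \<cdot>\<^sub>v unit_vec n j"
  have v: "v \<in> carrier_vec n" by (simp add: v_def)
  have Av: "A *\<^sub>v v = x \<cdot>\<^sub>v col A i + y \<cdot>\<^sub>v col A j"
    using A i j
    by (simp add: v_def mult_add_distrib_mat_vec[OF A] mult_mat_vec[OF A] mat_mult_unit_vec[OF A])
  have cols: "col A i \<in> carrier_vec n" "col A j \<in> carrier_vec n" using A by auto
  have "scalar_prod v (A *\<^sub>v v)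
      = x\<^sup>2 * A $$ (i, i) + 2 * x * y * A $$ (j, i) + y\<^sup>2 * A $$ (j, j)"
    unfolding Av unfolding v_def using cols A i j ij
    by (simp add: add_scalar_prod_distrib[of _ n] algebra_simps power2_eq_square)
  then show "0 \<le> x\<^sup>2 * A $$ (i, i) + 2 * x * y * A $$ (j, i) + y\<^sup>2 * A $$ (j, j)"
    using psd v unfolding psd_mat_def by metis
qed

lemma psd_mat_trace_nonneg:
  assumes "psd_mat n A"
  shows "0 \<le> mat_trace A"
proof -
  have "dim_row A = n" using assms by (auto simp: psd_mat_def)
  then show ?thesis
    using psd_mat_diag_nonneg[OF assms] by (auto simp: mat_trace_def intro!: sum_nonneg)
qed

text \<open>Summing the entry bound over all pairs makes the right-hand side factor into the square
  of the trace.\<close>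

lemma psd_mat_trace_square:
  assumes psd: "psd_mat n A"
  shows "mat_trace (transpose_mat A * A) \<le> (mat_trace A)\<^sup>2"
proof -
  have A: "A \<in> carrier_mat n n" using psd by (simp add: psd_mat_def)
  have "mat_trace (transpose_mat A * A) \<le> (\<Sum>i<n. \<Sum>j<n. A $$ (i, i) * A $$ (j, j))"
    unfolding mat_trace_transpose_mult_self[OF A]
    by (intro sum_mono) (simp add: psd_mat_entry_bound[OF psd])
  also have "\<dots> = (mat_trace A)\<^sup>2"
    using A by (simp add: mat_trace_def power2_eq_square sum_product)
  finally show ?thesis .
qed

text \<open>Cauchy-Schwarz for the diagonal against the all-ones vector; the squares of the
  off-diagonal entries are then added.\<close>

lemma mat_trace_square_le:
  assumes A: "A \<in> carrier_mat n n"
  shows "(mat_trace A)\<^sup>2 \<le> real n * mat_trace (transpose_mat A * A)"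
proof -
  have "(mat_trace A)\<^sup>2 \<le> real n * (\<Sum>i<n. (A $$ (i, i))\<^sup>2)"
    using A Cauchy_Schwarz_ineq_sum[of "\<lambda>_. 1" "\<lambda>i. A $$ (i, i)" "{..<n}"]
    by (simp add: mat_trace_def)
  also have "\<dots> \<le> real n * (\<Sum>i<n. \<Sum>j<n. (A $$ (j, i))\<^sup>2)"
    by (intro mult_left_mono sum_mono member_le_sum[where f = "\<lambda>j. (A $$ (j, _))\<^sup>2"]) auto
  finally show ?thesis by (simp add: mat_trace_transpose_mult_self[OF A])
qed

lemma linear_mat_map_trace_one:
  assumes lin: "linear_mat_map m n \<phi>"
  shows "mat_trace (\<phi> (1\<^sub>m m)) = (\<Sum>i<m. mat_trace (\<phi> (diag_unit m i)))"
proof -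
  have car: "\<phi> A \<in> carrier_mat n n" if "A \<in> carrier_mat m m" for A
    using lin that by (auto simp: linear_mat_map_def)
  have add: "mat_trace (\<phi> (A + B)) = mat_trace (\<phi> A) + mat_trace (\<phi> B)"
    if "A \<in> carrier_mat m m" "B \<in> carrier_mat m m" for A B
    using lin that by (simp add: linear_mat_map_def mat_trace_add[OF car car])
  have "mat_trace (\<phi> (diag_below m k)) = (\<Sum>i<k. mat_trace (\<phi> (diag_unit m i)))" for k
  proof (induction k)
    case 0
    \<comment> \<open>Additivity at \<open>0 + 0\<close> gives t = t + t for the trace t of the
      image of zero, so t = 0.\<close>
    show ?case using add[of "0\<^sub>m m m" "0\<^sub>m m m"] by (simp add: diag_below_0)
  next
    case (Suc k)
    then show ?case
      by (simp add: diag_below_Suc add diag_below_carrier diag_unit_carrier)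
  qed
  from this[of m] show ?thesis by (simp add: diag_below_self)
qed

text \<open>The deterministic core, used with \<open>a = 1 - \<epsilon>\<close> and
  \<open>b = 1 + \<epsilon>\<close>. The squared trace of the image of the identity lies between
  \<open>m\<^sup>2 * a\<close> and \<open>n * b * m\<close>; cancelling one factor \<open>m\<close>
  leaves the claim.\<close>

lemma positive_mat_map_dim_bound:
  assumes pos: "positive_mat_map m n \<phi>" and m: "0 < m" and a: "0 \<le> a"
    and lower: "\<And>i. i < m \<Longrightarrow>
      a \<le> mat_trace (transpose_mat (\<phi> (diag_unit m i)) * \<phi> (diag_unit m i))"
    and upper: "mat_trace (transpose_mat (\<phi> (1\<^sub>m m)) * \<phi> (1\<^sub>m m)) \<le> b * real m"
  shows "a * real m \<le> b * real n"
proof -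
  have lin: "linear_mat_map m n \<phi>" using pos by (simp add: positive_mat_map_def)
  have one: "\<phi> (1\<^sub>m m) \<in> carrier_mat n n" using lin by (auto simp: linear_mat_map_def)
  have "sqrt a \<le> mat_trace (\<phi> (diag_unit m i))" if "i < m" for i
  proof -
    have psd: "psd_mat n (\<phi> (diag_unit m i))"
      using pos psd_mat_diag_unit by (simp add: positive_mat_map_def)
    show ?thesis
      using psd_mat_trace_nonneg[OF psd] psd_mat_trace_square[OF psd] lower[OF that]
      by (intro real_le_lsqrt) linarith+
  qed
  then have "real m * sqrt a \<le> mat_trace (\<phi> (1\<^sub>m m))"
    using sum_bounded_below[of "{..<m}" "sqrt a" "\<lambda>i. mat_trace (\<phi> (diag_unit m i))"]
    by (simp add: linear_mat_map_trace_one[OF lin])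
  then have "(real m * sqrt a)\<^sup>2 \<le> (mat_trace (\<phi> (1\<^sub>m m)))\<^sup>2"
    using a by (intro power_mono) auto
  also have "\<dots> \<le> real n * (b * real m)"
    using mat_trace_square_le[OF one] mult_left_mono[OF upper, of "real n"] by linarith
  finally have "real m * (a * real m) \<le> real m * (b * real n)"
    using a by (simp add: power_mult_distrib power2_eq_square mult_ac)
  then show ?thesis using m by simp
qed

theorem theorem3p2:
  fixes \<epsilon> :: real
    and d :: "nat \<Rightarrow> nat"
    and M :: "nat \<Rightarrow> 'w measure"
    and \<Phi> :: "nat \<Rightarrow> 'w \<Rightarrow> real mat \<Rightarrow> real mat"
  assumes "0 < \<epsilon>" and "\<epsilon> < 1 / 4"
    and "\<And>D. 1 \<le> D \<Longrightarrow> random_positive_mat_map (M D) D (d D) (\<Phi> D)"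
    and "\<And>D Y. 1 \<le> D \<Longrightarrow> (\<forall>i\<in>{1..D + 1}. Y i \<in> carrier_mat D D) \<Longrightarrow>
      0 < \<P>(\<omega> in M D. \<forall>i\<in>{1..D + 1}. \<forall>j\<in>{1..D + 1}.
            \<bar>mat_trace (transpose_mat (\<Phi> D \<omega> (Y i)) * \<Phi> D \<omega> (Y j))
              - mat_trace (transpose_mat (Y i) * Y j)\<bar>
            \<le> \<epsilon> * schatten2_norm (Y i) * schatten2_norm (Y j))"
  shows "\<exists>c>0. \<exists>D0. \<forall>D\<ge>D0. c * real D \<le> real (d D)"
proof -
  \<comment> \<open>The constant is explicit, and \<open>D0 = 1\<close> works.\<close>
  have "(1 - \<epsilon>) / (1 + \<epsilon>) * real D \<le> real (d D)" if D: "1 \<le> D" for D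
  proof -
    \<comment> \<open>The family is indexed from 1 while matrix indices start at 0, hence the shift;
      the last slot holds the identity.\<close>
    define Y where "Y i = (if i = D + 1 then 1\<^sub>m D else diag_unit D (i - 1))" for i
    have Y: "Y i \<in> carrier_mat D D" for i by (simp add: Y_def diag_unit_carrier)
    let ?good = "\<lambda>\<omega>. \<forall>i\<in>{1..D + 1}. \<forall>j\<in>{1..D + 1}.
            \<bar>mat_trace (transpose_mat (\<Phi> D \<omega> (Y i)) * \<Phi> D \<omega> (Y j))
              - mat_trace (transpose_mat (Y i) * Y j)\<bar>
            \<le> \<epsilon> * schatten2_norm (Y i) * schatten2_norm (Y j)"
    have "0 < \<P>(\<omega> in M D. ?good \<omega>)" using assms(4)[OF D, of Y] Y by blast
    \<comment> \<open>The empty event has probability 0, so a good outcome exists; fixing one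
      removes the randomness.\<close>
    then have "{\<omega> \<in> space (M D). ?good \<omega>} \<noteq> {}" by (metis less_irrefl measure_empty)
    then obtain \<omega> where \<omega>: "\<omega> \<in> space (M D)" and good: "?good \<omega>" by blast
    define \<phi> where "\<phi> = \<Phi> D \<omega>"
    have "\<Phi> D \<in> measurable (M D) (positive_mat_maps D (d D))"
      using assms(3)[OF D] by (simp add: random_positive_mat_map_def)
    \<comment> \<open>Measurability places the chosen value in the space of the target, which
      consists of the positive maps.\<close>
    from measurable_space[OF this \<omega>] have pos: "positive_mat_map D (d D) \<phi>"
      by (simp add: \<phi>_def positive_mat_maps_def space_measure_of_conv)
    \<comment> \<open>For \<open>i = j\<close> the product of the two norms is the squared norm
      itself, so the hypothesis becomes a relative error of \<open>\<epsilon>\<close> in squared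
      norms.\<close>
    have near: "\<bar>mat_trace (transpose_mat (\<phi> (Y i)) * \<phi> (Y i))
        - mat_trace (transpose_mat (Y i) * Y i)\<bar> \<le> \<epsilon> * mat_trace (transpose_mat (Y i) * Y i)"
      if "i \<in> {1..D + 1}" for i
      using good[rule_format, OF that that] schatten2_norm_mult_self[OF Y, of i]
      by (simp add: \<phi>_def mult.assoc)
    have "(1 - \<epsilon>) * real D \<le> (1 + \<epsilon>) * real (d D)"
    proof (rule positive_mat_map_dim_bound[OF pos])
      fix i assume i: "i < D"
      then show "1 - \<epsilon> \<le> mat_trace (transpose_mat (\<phi> (diag_unit D i)) * \<phi> (diag_unit D i))"
        using near[of "Suc i"] by (simp add: Y_def mat_trace_diag_unit)
    next
      show "mat_trace (transpose_mat (\<phi> (1\<^sub>m D)) * \<phi> (1\<^sub>m D)) \<le> (1 + \<epsilon>) * real D"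
        using near[of "D + 1"] mat_trace_one[of D] by (simp add: Y_def algebra_simps)
    qed (use D assms(2) in auto)
    then show ?thesis using assms(1) by (simp add: field_simps)
  qed
  moreover have "0 < (1 - \<epsilon>) / (1 + \<epsilon>)" using assms(1,2) by simp
  ultimately show ?thesis by blast
qed

end
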